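(* Let $G$ be a countable group. If $G$ is virtually torsion free, then $G$ is finitely embeddable into Hilbert space.
   Context: A group is virtually torsion free if it has a torsion free subgroup of finite index. A countable discrete group $G'$ is coarsely embeddable into a Hilbert space $H$ if there is a map $f:G'\to H$ such that (i) for any finite $F\subseteq G'$ there is $R>0$ such that $g^{-1}h\in F$ implies $d(f(g),f(h))\le R$; (ii) for any $S>0$ there is a finite $E\subseteq G'$ such that $g^{-1}h\in G'-E$ implies $d(f(g),f(h))\ge S$. A countable discrete group $G$ is finitely embeddable into Hilbert space $H$ if for any finite subset $F\subseteq G$ there exist a group $G'$ coarsely embeddable into $H$ and a map $\phi:F\to G'$ such that (i) $\phi(gh)=\phi(g)\phi(h)$ if $g,h\in F$ and $gh\in F$; (ii) if $g\in F$ has finite order, then $\mathrm{order}(\phi(g))=\mathrm{order}(g)$. *)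

theory Defs
  imports "HOL-Analysis.Inner_Product" "HOL-Library.Countable_Set" "HOL-Algebra.Algebra"
begin

definition torsion_free :: "('a, 'm) monoid_scheme \<Rightarrow> bool" where
  "torsion_free G \<longleftrightarrow>
     (\<forall>x \<in> carrier G. x \<noteq> \<one>\<^bsub>G\<^esub> \<longrightarrow> (\<forall>n::nat. n > 0 \<longrightarrow> x [^]\<^bsub>G\<^esub> n \<noteq> \<one>\<^bsub>G\<^esub>))"

definition virtually_torsion_free :: "('a, 'm) monoid_scheme \<Rightarrow> bool" where
  "virtually_torsion_free G \<longleftrightarrow>
     (\<exists>K. subgroup K G \<and> torsion_free (G\<lparr>carrier := K\<rparr>) \<and> finite (rcosets\<^bsub>G\<^esub> K))"

text \<open>
  A real Hilbert space \<open>H\<close> is represented by a type \<open>'h\<close> that is a complete real inner product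
  space.  A complex Hilbert space is covered through the real part of its inner product, since
  only its metric matters here.
\<close>

definition coarse_embedding ::
    "('a, 'm) monoid_scheme \<Rightarrow> ('a \<Rightarrow> 'h::{real_inner, complete_space}) \<Rightarrow> bool" where
  "coarse_embedding G f \<longleftrightarrow>
     (\<forall>F. finite F \<and> F \<subseteq> carrier G \<longrightarrow>
        (\<exists>R>0. \<forall>g\<in>carrier G. \<forall>h\<in>carrier G.
            inv\<^bsub>G\<^esub> g \<otimes>\<^bsub>G\<^esub> h \<in> F \<longrightarrow> dist (f g) (f h) \<le> R)) \<and>
     (\<forall>S>0. \<exists>E. finite E \<and> E \<subseteq> carrier G \<and>
        (\<forall>g\<in>carrier G. \<forall>h\<in>carrier G.
            inv\<^bsub>G\<^esub> g \<otimes>\<^bsub>G\<^esub> h \<in> carrier G - E \<longrightarrow> dist (f g) (f h) \<ge> S))"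

definition coarsely_embeddable ::
    "'h::{real_inner, complete_space} itself \<Rightarrow> ('a, 'm) monoid_scheme \<Rightarrow> bool" where
  "coarsely_embeddable H G \<longleftrightarrow> (\<exists>f :: 'a \<Rightarrow> 'h. coarse_embedding G f)"

text \<open>
  HOL cannot quantify existentially over the carrier type of \<open>G'\<close>.  Since \<open>G'\<close> is countable, it
  is isomorphic to a group whose carrier is a set of natural numbers; the lemma
  \<open>finitely_embeddableI\<close> below shows that witnesses of any other type are equally good.
  Note that \<^term>\<open>group.ord G g = 0\<close> encodes that \<open>g\<close> has infinite order.
\<close>

definition finitely_embeddable ::
    "'h::{real_inner, complete_space} itself \<Rightarrow> ('a, 'm) monoid_scheme \<Rightarrow> bool" where
  "finitely_embeddable H G \<longleftrightarrow>
     (\<forall>F. finite F \<and> F \<subseteq> carrier G \<longrightarrow>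
        (\<exists>(G' :: nat monoid) \<phi>. group G' \<and> coarsely_embeddable H G' \<and>
           \<phi> \<in> F \<rightarrow> carrier G' \<and>
           (\<forall>g\<in>F. \<forall>h\<in>F. g \<otimes>\<^bsub>G\<^esub> h \<in> F \<longrightarrow> \<phi> (g \<otimes>\<^bsub>G\<^esub> h) = \<phi> g \<otimes>\<^bsub>G'\<^esub> \<phi> h) \<and>
           (\<forall>g\<in>F. group.ord G g \<noteq> 0 \<longrightarrow> group.ord G' (\<phi> g) = group.ord G g)))"

lemma coarsely_embeddable_iso:
  fixes H :: "'h::{real_inner, complete_space} itself"
  assumes G: "group G" and K: "group K" and e: "e \<in> iso G K"
    and ce: "coarsely_embeddable H G"
  shows "coarsely_embeddable H K"
proof -
  interpret G: group G by fact
  interpret K: group K by fact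
  interpret e: group_hom G K e
    using e by unfold_locales (auto simp: iso_def)
  define d where "d = inv_into (carrier G) e"
  have bij: "bij_betw e (carrier G) (carrier K)" using e by (auto simp: iso_def)
  have "d \<in> iso K G" unfolding d_def using G.iso_set_sym[OF e] .
  then interpret d: group_hom K G d
    by unfold_locales (auto simp: iso_def)
  have ed: "e (d x) = x" if "x \<in> carrier K" for x
    using that unfolding d_def by (rule bij_betw_inv_into_right[OF bij])
  from ce obtain f :: "_ \<Rightarrow> 'h" where f: "coarse_embedding G f"
    unfolding coarsely_embeddable_def by blast
  have dm: "inv\<^bsub>G\<^esub> (d g) \<otimes>\<^bsub>G\<^esub> d h = d (inv\<^bsub>K\<^esub> g \<otimes>\<^bsub>K\<^esub> h)" if "g \<in> carrier K" "h \<in> carrier K" for g h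
    using that by simp
  have "coarse_embedding K (f \<circ> d)"
    unfolding coarse_embedding_def
  proof (intro conjI allI impI)
    fix F assume F: "finite F \<and> F \<subseteq> carrier K"
    then have "finite (d ` F) \<and> d ` F \<subseteq> carrier G" by auto
    from conjunct1[OF f[unfolded coarse_embedding_def], THEN spec, THEN mp, OF this]
    obtain R where "R > 0" and R: "\<forall>g\<in>carrier G. \<forall>h\<in>carrier G.
        inv\<^bsub>G\<^esub> g \<otimes>\<^bsub>G\<^esub> h \<in> d ` F \<longrightarrow> dist (f g) (f h) \<le> R"
      by (elim exE conjE)
    have "\<forall>g\<in>carrier K. \<forall>h\<in>carrier K.
        inv\<^bsub>K\<^esub> g \<otimes>\<^bsub>K\<^esub> h \<in> F \<longrightarrow> dist ((f \<circ> d) g) ((f \<circ> d) h) \<le> R"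
    proof (intro ballI impI)
      fix g h assume "g \<in> carrier K" "h \<in> carrier K" "inv\<^bsub>K\<^esub> g \<otimes>\<^bsub>K\<^esub> h \<in> F"
      then have "inv\<^bsub>G\<^esub> (d g) \<otimes>\<^bsub>G\<^esub> d h \<in> d ` F" "d g \<in> carrier G" "d h \<in> carrier G"
        by (simp_all only: dm imageI d.hom_closed)
      then show "dist ((f \<circ> d) g) ((f \<circ> d) h) \<le> R"
        using R by simp
    qed
    with \<open>R > 0\<close> show "\<exists>R>0. \<forall>g\<in>carrier K. \<forall>h\<in>carrier K.
        inv\<^bsub>K\<^esub> g \<otimes>\<^bsub>K\<^esub> h \<in> F \<longrightarrow> dist ((f \<circ> d) g) ((f \<circ> d) h) \<le> R" by blast
  next
    fix S :: real assume "S > 0"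
    from conjunct2[OF f[unfolded coarse_embedding_def], THEN spec, THEN mp, OF this]
    obtain E where E: "finite E" "E \<subseteq> carrier G" and S: "\<forall>g\<in>carrier G. \<forall>h\<in>carrier G.
        inv\<^bsub>G\<^esub> g \<otimes>\<^bsub>G\<^esub> h \<in> carrier G - E \<longrightarrow> dist (f g) (f h) \<ge> S"
      by (elim exE conjE)
    have "dist ((f \<circ> d) g) ((f \<circ> d) h) \<ge> S"
      if "g \<in> carrier K" "h \<in> carrier K" "inv\<^bsub>K\<^esub> g \<otimes>\<^bsub>K\<^esub> h \<in> carrier K - e ` E" for g h
    proof -
      define x where "x = inv\<^bsub>K\<^esub> g \<otimes>\<^bsub>K\<^esub> h"
      have x: "x \<in> carrier K" "x \<notin> e ` E" using that(3) by (auto simp: x_def)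
      have "d x \<notin> E" using x(2) ed[OF x(1)] by force
      with x(1) have "inv\<^bsub>G\<^esub> (d g) \<otimes>\<^bsub>G\<^esub> d h \<in> carrier G - E"
        unfolding dm[OF that(1,2)] x_def[symmetric] by (simp add: d.hom_closed)
      with S that(1,2) show ?thesis by (simp add: d.hom_closed)
    qed
    then show "\<exists>E. finite E \<and> E \<subseteq> carrier K \<and> (\<forall>g\<in>carrier K. \<forall>h\<in>carrier K.
        inv\<^bsub>K\<^esub> g \<otimes>\<^bsub>K\<^esub> h \<in> carrier K - E \<longrightarrow> dist ((f \<circ> d) g) ((f \<circ> d) h) \<ge> S)"
      using E by (intro exI[of _ "e ` E"]) auto
  qed
  then show ?thesis unfolding coarsely_embeddable_def by blast
qed

lemma finitely_embeddableI:
  assumes "\<And>F. finite F \<Longrightarrow> F \<subseteq> carrier G \<Longrightarrow>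
     \<exists>(G' :: ('b, 'n) monoid_scheme) \<phi>. group G' \<and> countable (carrier G') \<and>
       coarsely_embeddable H G' \<and> \<phi> \<in> F \<rightarrow> carrier G' \<and>
       (\<forall>g\<in>F. \<forall>h\<in>F. g \<otimes>\<^bsub>G\<^esub> h \<in> F \<longrightarrow> \<phi> (g \<otimes>\<^bsub>G\<^esub> h) = \<phi> g \<otimes>\<^bsub>G'\<^esub> \<phi> h) \<and>
       (\<forall>g\<in>F. group.ord G g \<noteq> 0 \<longrightarrow> group.ord G' (\<phi> g) = group.ord G g)"
  shows "finitely_embeddable H G"
  unfolding finitely_embeddable_def
proof (intro allI impI)
  fix F assume F: "finite F \<and> F \<subseteq> carrier G"
  from assms[OF conjunct1[OF F] conjunct2[OF F]]
  obtain G' :: "('b, 'n) monoid_scheme" and \<phi> where *: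
    "group G' \<and> countable (carrier G') \<and> coarsely_embeddable H G' \<and> \<phi> \<in> F \<rightarrow> carrier G' \<and>
      (\<forall>g\<in>F. \<forall>h\<in>F. g \<otimes>\<^bsub>G\<^esub> h \<in> F \<longrightarrow> \<phi> (g \<otimes>\<^bsub>G\<^esub> h) = \<phi> g \<otimes>\<^bsub>G'\<^esub> \<phi> h) \<and>
      (\<forall>g\<in>F. group.ord G g \<noteq> 0 \<longrightarrow> group.ord G' (\<phi> g) = group.ord G g)"
    by (elim exE)
  then have G': "group G'" "countable (carrier G')" "coarsely_embeddable H G'"
    and \<phi>: "\<phi> \<in> F \<rightarrow> carrier G'"
      "\<And>g h. g \<in> F \<Longrightarrow> h \<in> F \<Longrightarrow> g \<otimes>\<^bsub>G\<^esub> h \<in> F \<Longrightarrow> \<phi> (g \<otimes>\<^bsub>G\<^esub> h) = \<phi> g \<otimes>\<^bsub>G'\<^esub> \<phi> h"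
      "\<And>g. g \<in> F \<Longrightarrow> group.ord G g \<noteq> 0 \<Longrightarrow> group.ord G' (\<phi> g) = group.ord G g"
    by simp_all
  interpret G': group G' by fact
  define e where "e = to_nat_on (carrier G')"
  have inj: "inj_on e (carrier G')" unfolding e_def using G'(2) by (rule inj_on_to_nat_on)
  define K where "K = image_group e G'"
  have iK: "e \<in> iso G' K" unfolding K_def using inj by (rule inj_imp_image_group_iso)
  have "group K" unfolding K_def using inj by (rule G'.inj_imp_image_group_is_group)
  then interpret K: group K .
  interpret e: group_hom G' K e
    using iK by unfold_locales (auto simp: iso_def)
  have ord: "K.ord (e x) = G'.ord x" if x: "x \<in> carrier G'" for x
  proof -
    have "e x [^]\<^bsub>K\<^esub> n = \<one>\<^bsub>K\<^esub> \<longleftrightarrow> x [^]\<^bsub>G'\<^esub> n = \<one>\<^bsub>G'\<^esub>" for n :: nat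
    proof -
      have "e x [^]\<^bsub>K\<^esub> n = \<one>\<^bsub>K\<^esub> \<longleftrightarrow> e (x [^]\<^bsub>G'\<^esub> n) = e \<one>\<^bsub>G'\<^esub>"
        using e.hom_nat_pow[OF x] e.hom_one by simp
      also have "\<dots> \<longleftrightarrow> x [^]\<^bsub>G'\<^esub> n = \<one>\<^bsub>G'\<^esub>"
        by (rule inj_on_eq_iff[OF inj]) (simp_all add: x)
      finally show ?thesis .
    qed
    then show ?thesis by (simp add: K.ord_def G'.ord_def)
  qed
  show "\<exists>(G' :: nat monoid) \<phi>. group G' \<and> coarsely_embeddable H G' \<and>
           \<phi> \<in> F \<rightarrow> carrier G' \<and>
           (\<forall>g\<in>F. \<forall>h\<in>F. g \<otimes>\<^bsub>G\<^esub> h \<in> F \<longrightarrow> \<phi> (g \<otimes>\<^bsub>G\<^esub> h) = \<phi> g \<otimes>\<^bsub>G'\<^esub> \<phi> h) \<and>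
           (\<forall>g\<in>F. group.ord G g \<noteq> 0 \<longrightarrow> group.ord G' (\<phi> g) = group.ord G g)"
  proof (intro exI[of _ K] exI[of _ "e \<circ> \<phi>"] conjI ballI impI)
    show "group K" ..
    show "coarsely_embeddable H K"
      using coarsely_embeddable_iso[OF G'(1) _ iK G'(3)] K.is_group by simp
    show "e \<circ> \<phi> \<in> F \<rightarrow> carrier K" using \<phi>(1) by (simp add: Pi_iff)
  next
    fix g h assume "g \<in> F" "h \<in> F" "g \<otimes>\<^bsub>G\<^esub> h \<in> F"
    then show "(e \<circ> \<phi>) (g \<otimes>\<^bsub>G\<^esub> h) = (e \<circ> \<phi>) g \<otimes>\<^bsub>K\<^esub> (e \<circ> \<phi>) h"
      using \<phi>(1) by (simp add: \<phi>(2) Pi_iff)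
  next
    fix g assume "g \<in> F" "group.ord G g \<noteq> 0"
    then show "K.ord ((e \<circ> \<phi>) g) = group.ord G g"
      using \<phi>(1) by (simp add: \<phi>(3) ord Pi_iff)
  qed
qed

end

theory Submission
  imports Defs
begin

text \<open>
  The map \<open>\<phi>\<close> in the definition of finite embeddability need not be injective.  If \<open>K\<close> is a
  torsion free subgroup of finite index, then \<open>G\<close> acts on the finite set of cosets of \<open>K\<close>, and this
  homomorphism into a finite permutation group preserves finite orders: its kernel is contained
  in \<open>K\<close>, so it contains no nontrivial element of finite order.  Finite groups embed coarsely
  into every Hilbert space.
\<close>

lemma coarsely_embeddable_finite:
  assumes "finite (carrier G)"
  shows "coarsely_embeddable H G"
proof -
  \<comment> \<open>A constant map works: every distance is 0, so \<open>R = 1\<close> bounds it,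
    and taking the whole carrier as \<open>E\<close> leaves no pair to be separated.\<close>
  have "coarse_embedding G (\<lambda>_. 0)"
    unfolding coarse_embedding_def
    using assms by (auto intro!: exI[of _ 1] exI[of _ "carrier G"])
  then show ?thesis
    unfolding coarsely_embeddable_def by blast
qed

text \<open>Extensionality is what makes this true: it places \<open>Bij S\<close> inside a finite
  function space.\<close>

lemma finite_Bij: "finite S \<Longrightarrow> finite (Bij S)"
  using Bij_imp_extensional Bij_imp_funcset
  by (intro finite_subset[of "Bij S" "S \<rightarrow>\<^sub>E S"] finite_PiE) (unfold PiE_def, blast+)

context group
begin

lemma rcoset_mult_in_rcosets:
  assumes "subgroup K G" "C \<in> rcosets K" "g \<in> carrier G"
  shows "C #> g \<in> rcosets K"
  using assms
  by (auto simp: RCOSETS_def coset_mult_assoc[OF subgroup.subset[OF assms(1)]])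

text \<open>Translating right cosets by \<open>inv g\<close> instead of \<open>g\<close> turns right
  multiplication into a left action, since inversion reverses products. The restriction gives the
  extensional maps that \<open>BijGroup\<close> requires.\<close>

lemma rcoset_action:
  assumes K: "subgroup K G"
  shows "group_action G (rcosets K) (\<lambda>g. \<lambda>C \<in> rcosets K. C #> inv g)"
proof -
  have C: "C \<subseteq> carrier G" if "C \<in> rcosets K" for C
    using subgroup.rcosets_carrier[OF K is_group that] .
  have Bij: "(\<lambda>C \<in> rcosets K. C #> inv g) \<in> Bij (rcosets K)" if g: "g \<in> carrier G" for g
  proof -
    have "bij_betw (\<lambda>C. C #> inv g) (rcosets K) (rcosets K)"
      by (rule bij_betw_byWitness[where f' = "\<lambda>C. C #> g"])
        (auto simp: C g coset_mult_assoc rcoset_mult_in_rcosets[OF K])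
    then show ?thesis
      by (simp add: Bij_def)
  qed
  have "(\<lambda>C \<in> rcosets K. C #> inv (g \<otimes> h)) =
      compose (rcosets K) (\<lambda>C \<in> rcosets K. C #> inv g) (\<lambda>C \<in> rcosets K. C #> inv h)"
    if "g \<in> carrier G" "h \<in> carrier G" for g h
    using that
    by (auto simp: compose_def fun_eq_iff C coset_mult_assoc inv_mult_group
        rcoset_mult_in_rcosets[OF K])
  then have "(\<lambda>g. \<lambda>C \<in> rcosets K. C #> inv g) \<in> hom G (BijGroup (rcosets K))"
    by (intro homI) (simp_all add: BijGroup_def Bij)
  then show ?thesis
    by (simp add: group_action_def group_hom_def group_hom_axioms_def is_group group_BijGroup)
qed

text \<open>It suffices to look at the coset \<open>K\<close> itself, whose stabilizer is
  \<open>K\<close>.\<close>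

lemma rcoset_action_kernel_subset:
  assumes K: "subgroup K G"
    and g: "g \<in> carrier G"
    and eq: "(\<lambda>C \<in> rcosets K. C #> inv g) = \<one>\<^bsub>BijGroup (rcosets K)\<^esub>"
  shows "g \<in> K"
proof -
  have "K \<in> rcosets K"
    using K by (metis coset_mult_one one_closed rcosetsI subgroup.subset)
  then have "K #> inv g = K"
    using fun_cong[OF eq, of K] by (simp add: BijGroup_def)
  then have "inv g \<in> K"
    using coset_join1 g K by blast
  then show ?thesis
    using g K subgroup.m_inv_closed by fastforce
qed

lemma torsion_free_subgroup_pow_eq_one:
  fixes n :: nat
  assumes "torsion_free (G\<lparr>carrier := K\<rparr>)" "x \<in> K" "x [^] n = \<one>" "n > 0"
  shows "x = \<one>"
  using assms by (auto simp: torsion_free_def simp flip: nat_pow_consistent)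

end

text \<open>The second assumption makes \<open>h\<close> kill no nontrivial power of
  \<open>x\<close>, so \<open>x\<close> and \<open>h x\<close> have the same trivial powers, and
  these determine the order.\<close>

lemma (in group_hom) ord_hom_eq:
  assumes "x \<in> carrier G"
    and "\<And>n::nat. h (x [^] n) = \<one>\<^bsub>H\<^esub> \<Longrightarrow> x [^] n = \<one>"
  shows "group.ord H (h x) = group.ord G x"
proof -
  have "h x [^]\<^bsub>H\<^esub> n = \<one>\<^bsub>H\<^esub> \<longleftrightarrow> x [^] n = \<one>" for n :: nat
    using assms by (metis hom_nat_pow hom_one)
  then show ?thesis
    by (simp add: G.ord_def H.ord_def)
qed

theorem corollary5p5:
  fixes G :: "('a, 'm) monoid_scheme"
  assumes "group G"
    and "countable (carrier G)"
    and "virtually_torsion_free G"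
  shows "finitely_embeddable TYPE('h::{real_inner, complete_space}) G"
proof -
  interpret group G by fact
  obtain K where K: "subgroup K G" "torsion_free (G\<lparr>carrier := K\<rparr>)"
    and fin: "finite (rcosets\<^bsub>G\<^esub> K)"
    using assms(3) unfolding virtually_torsion_free_def by blast
  define Q where "Q = BijGroup (rcosets\<^bsub>G\<^esub> K)"
  define \<phi> where "\<phi> g = (\<lambda>C \<in> rcosets\<^bsub>G\<^esub> K. C #>\<^bsub>G\<^esub> inv\<^bsub>G\<^esub> g)" for g
  interpret \<phi>: group_hom G Q \<phi>
    using group_action.group_hom[OF rcoset_action[OF K(1)]] unfolding Q_def \<phi>_def .
  have finQ: "finite (carrier Q)"
    using finite_Bij[OF fin] by (simp add: Q_def BijGroup_def)
  have ord: "\<phi>.H.ord (\<phi> g) = ord g" if g: "g \<in> carrier G" and "ord g \<noteq> 0" for g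
  proof (rule \<phi>.ord_hom_eq[OF g])
    fix n :: nat
    assume "\<phi> (g [^]\<^bsub>G\<^esub> n) = \<one>\<^bsub>Q\<^esub>"
    then have "g [^]\<^bsub>G\<^esub> n \<in> K"
      using rcoset_action_kernel_subset[OF K(1)] g unfolding Q_def \<phi>_def by simp
    \<comment> \<open>Exponents commute, so \<open>g [^] n\<close> is a torsion element, and it lies
      in the torsion free \<open>K\<close>.\<close>
    moreover have "(g [^]\<^bsub>G\<^esub> n) [^]\<^bsub>G\<^esub> ord g = \<one>\<^bsub>G\<^esub>"
      using g by (simp add: nat_pow_pow pow_eq_id)
    ultimately show "g [^]\<^bsub>G\<^esub> n = \<one>\<^bsub>G\<^esub>"
      using torsion_free_subgroup_pow_eq_one[OF K(2)] \<open>ord g \<noteq> 0\<close> by blast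
  qed
  show ?thesis
  \<comment> \<open>The elements of \<open>Q\<close> are maps on cosets rather than numbers, hence
    this rule. The same pair \<open>Q\<close>, \<open>\<phi>\<close> serves every
    \<open>F\<close>.\<close>
  proof (rule finitely_embeddableI)
    fix F
    assume F: "finite F" "F \<subseteq> carrier G"
    show "\<exists>(G' :: ('a set \<Rightarrow> 'a set) monoid) \<phi>. group G' \<and> countable (carrier G') \<and>
       coarsely_embeddable TYPE('h) G' \<and> \<phi> \<in> F \<rightarrow> carrier G' \<and>
       (\<forall>g\<in>F. \<forall>h\<in>F. g \<otimes>\<^bsub>G\<^esub> h \<in> F \<longrightarrow> \<phi> (g \<otimes>\<^bsub>G\<^esub> h) = \<phi> g \<otimes>\<^bsub>G'\<^esub> \<phi> h) \<and>
       (\<forall>g\<in>F. group.ord G g \<noteq> 0 \<longrightarrow> group.ord G' (\<phi> g) = group.ord G g)"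
      using F finQ
      by (intro exI[of _ Q] exI[of _ \<phi>])
        (auto simp: subset_iff ord coarsely_embeddable_finite countable_finite
          \<phi>.H.is_group)
  qed
qed

end
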